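(* Let $M,N$ be $\tau$-structures such that $M\equiv N$ (i.e. $\sigma^M=\sigma^N$ for every linear $\tau$-sentence $\sigma$) and both are linearly $\aleph_0$-saturated. Then $M\equiv_{CL}N$, i.e. $\sigma^M=\sigma^N$ for every CL sentence $\sigma$ of $\tau$.
   Context: Logic. A modulus is an increasing continuous concave function $\lambda:[0,\infty)\to[0,\infty)$ with $\lambda(0)=0$; a map $f$ between metric spaces is $\lambda$-continuous if $d(f(x),f(y))\le\lambda(d(x,y))$ for all $x,y$. A signature $\tau$ is a set of function, relation and constant symbols; each function symbol $F$ has a modulus $\lambda_F$, each relation symbol $R$ has a modulus $\lambda_R$ and a bound $\mathbf b_R\ge0$; $\tau$ contains a distinguished binary relation symbol $d$ with $\mathbf b_d=1$. A $\tau$-structure is a (not necessarily complete) metric space $(M,d)$ with $d$ interpreted as the metric (so diameter $\le1$), each $F^M:M^n\to M$ being $\lambda_F$-continuous, each $R^M:M^n\to\mathbb R$ being $\lambda_R$-continuous with $|R^M|\le\mathbf b_R$, where $M^n$ carries the metric $\sum_{i=1}^n d(x_i,y_i)$. CL formulas are built inductively from $r$ ($r\in\mathbb R$), $d(t_1,t_2)$, $R(t_1,\dots,t_n)$ ($t_i$ terms) by $r\phi$, $\phi+\psi$, $\phi\wedge\psi$ (minimum), $\phi\vee\psi$ (maximum), $\sup_x\phi$, $\inf_x\phi$, and evaluated in the obvious way; linear formulas are those built without $\wedge,\vee$. A linear condition is $\phi\le\psi$ with $\phi,\psi$ linear formulas. Types. For $A\subseteq M$, let $T_A$ be the set of all closed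 linear conditions with parameters from $A$ true in $M$. An element of $S_n(A)$ (a linear $n$-type over $A$) is a maximal set $p(\bar x)$ of linear conditions $\phi(\bar x)\le\psi(\bar x)$, $|\bar x|=n$, with parameters in $A$ such that $T_A\cup p(\bar x)$ is satisfied by some tuple in some model of $T_A$. It is realized in $M$ if some $\bar a\in M^n$ satisfies all its conditions. $M$ is linearly $\kappa$-saturated if every $p\in S_1(A)$ is realized in $M$ whenever $A\subseteq M$ and $|A|<\kappa$. *)

theory Defs
  imports "HOL-Analysis.Analysis"
begin

unbundle cardinal_syntax

section \<open>Signatures and structures\<close>

definition modulus :: "(real \<Rightarrow> real) \<Rightarrow> bool" where
  "modulus lam \<longleftrightarrow>
     lam ` {0..} \<subseteq> {0..} \<and> mono_on {0..} lam \<and> continuous_on {0..} lam \<and>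
     concave_on {0..} lam \<and> lam 0 = 0"

definition lam_continuous ::
  "(real \<Rightarrow> real) \<Rightarrow> 'x set \<Rightarrow> ('x \<Rightarrow> 'x \<Rightarrow> real) \<Rightarrow> ('y \<Rightarrow> 'y \<Rightarrow> real) \<Rightarrow> ('x \<Rightarrow> 'y) \<Rightarrow> bool" where
  "lam_continuous lam X dX dY f \<longleftrightarrow> (\<forall>x\<in>X. \<forall>y\<in>X. dY (f x) (f y) \<le> lam (dX x y))"

text \<open>
  The symbols of a signature form subsets of the types \<open>'f\<close>, \<open>'r\<close>, \<open>'c\<close>, so that there may be
  no function or constant symbols at all. The symbol \<open>dsym\<close> is the distinguished \<open>d\<close>.
\<close>

record ('f, 'r, 'c) signature =
  fsyms :: "'f set"
  rsyms :: "'r set"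
  csyms :: "'c set"
  farity :: "'f \<Rightarrow> nat"
  rarity :: "'r \<Rightarrow> nat"
  fmod :: "'f \<Rightarrow> real \<Rightarrow> real"
  rmod :: "'r \<Rightarrow> real \<Rightarrow> real"
  rbound :: "'r \<Rightarrow> real"
  dsym :: "'r"

definition is_signature :: "('f, 'r, 'c) signature \<Rightarrow> bool" where
  "is_signature \<tau> \<longleftrightarrow>
     (\<forall>F\<in>fsyms \<tau>. modulus (fmod \<tau> F)) \<and>
     (\<forall>R\<in>rsyms \<tau>. modulus (rmod \<tau> R) \<and> 0 \<le> rbound \<tau> R) \<and>
     dsym \<tau> \<in> rsyms \<tau> \<and> rarity \<tau> (dsym \<tau>) = 2 \<and> rbound \<tau> (dsym \<tau>) = 1"

record ('f, 'r, 'c, 'a) lstruct =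
  univ :: "'a set"
  funI :: "'f \<Rightarrow> 'a list \<Rightarrow> 'a"
  relI :: "'r \<Rightarrow> 'a list \<Rightarrow> real"
  constI :: "'c \<Rightarrow> 'a"

definition tuples :: "'a set \<Rightarrow> nat \<Rightarrow> 'a list set" where
  "tuples U n = {xs. set xs \<subseteq> U \<and> length xs = n}"

text \<open>
  The locale \<open>Metric_space\<close> asks for symmetry and nonnegativity on the whole type. Cutting the
  distance off outside the universe makes this a condition on the universe only.
\<close>

definition mdist :: "('f, 'r, 'c) signature \<Rightarrow> ('f, 'r, 'c, 'a) lstruct \<Rightarrow> 'a \<Rightarrow> 'a \<Rightarrow> real" where
  "mdist \<tau> M x y = (if x \<in> univ M \<and> y \<in> univ M then relI M (dsym \<tau>) [x, y] else 0)"

definition tdist :: "('f, 'r, 'c) signature \<Rightarrow> ('f, 'r, 'c, 'a) lstruct \<Rightarrow> 'a list \<Rightarrow> 'a list \<Rightarrow> real" where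
  "tdist \<tau> M xs ys = (\<Sum>i<length xs. mdist \<tau> M (xs ! i) (ys ! i))"

definition is_structure :: "('f, 'r, 'c) signature \<Rightarrow> ('f, 'r, 'c, 'a) lstruct \<Rightarrow> bool" where
  "is_structure \<tau> M \<longleftrightarrow>
     univ M \<noteq> {} \<and> Metric_space (univ M) (mdist \<tau> M) \<and>
     (\<forall>F\<in>fsyms \<tau>.
        funI M F ` tuples (univ M) (farity \<tau> F) \<subseteq> univ M \<and>
        lam_continuous (fmod \<tau> F) (tuples (univ M) (farity \<tau> F)) (tdist \<tau> M) (mdist \<tau> M) (funI M F)) \<and>
     (\<forall>R\<in>rsyms \<tau>.
        lam_continuous (rmod \<tau> R) (tuples (univ M) (rarity \<tau> R)) (tdist \<tau> M) dist (relI M R) \<and>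
        (\<forall>xs\<in>tuples (univ M) (rarity \<tau> R). \<bar>relI M R xs\<bar> \<le> rbound \<tau> R)) \<and>
     constI M ` csyms \<tau> \<subseteq> univ M"


section \<open>Formulas\<close>

datatype ('f, 'c) trm = Var nat | Cst 'c | App 'f "('f, 'c) trm list"

text \<open>The atomic formula \<open>d(t, u)\<close> is \<open>Rel (dsym \<tau>) [t, u]\<close>.\<close>

datatype ('f, 'r, 'c) fm =
    Num real
  | Rel 'r "('f, 'c) trm list"
  | Scale real "('f, 'r, 'c) fm"
  | Add "('f, 'r, 'c) fm" "('f, 'r, 'c) fm"
  | And "('f, 'r, 'c) fm" "('f, 'r, 'c) fm"
  | Or "('f, 'r, 'c) fm" "('f, 'r, 'c) fm"
  | SupQ nat "('f, 'r, 'c) fm"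
  | InfQ nat "('f, 'r, 'c) fm"

primrec wf_trm :: "('f, 'r, 'c) signature \<Rightarrow> ('f, 'c) trm \<Rightarrow> bool" where
  "wf_trm \<tau> (Var x) \<longleftrightarrow> True"
| "wf_trm \<tau> (Cst c) \<longleftrightarrow> c \<in> csyms \<tau>"
| "wf_trm \<tau> (App F ts) \<longleftrightarrow> F \<in> fsyms \<tau> \<and> length ts = farity \<tau> F \<and> list_all (wf_trm \<tau>) ts"

primrec CL_formula :: "('f, 'r, 'c) signature \<Rightarrow> ('f, 'r, 'c) fm \<Rightarrow> bool" where
  "CL_formula \<tau> (Num r) \<longleftrightarrow> True"
| "CL_formula \<tau> (Rel R ts) \<longleftrightarrow> R \<in> rsyms \<tau> \<and> length ts = rarity \<tau> R \<and> list_all (wf_trm \<tau>) ts"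
| "CL_formula \<tau> (Scale r \<phi>) \<longleftrightarrow> CL_formula \<tau> \<phi>"
| "CL_formula \<tau> (Add \<phi> \<psi>) \<longleftrightarrow> CL_formula \<tau> \<phi> \<and> CL_formula \<tau> \<psi>"
| "CL_formula \<tau> (And \<phi> \<psi>) \<longleftrightarrow> CL_formula \<tau> \<phi> \<and> CL_formula \<tau> \<psi>"
| "CL_formula \<tau> (Or \<phi> \<psi>) \<longleftrightarrow> CL_formula \<tau> \<phi> \<and> CL_formula \<tau> \<psi>"
| "CL_formula \<tau> (SupQ x \<phi>) \<longleftrightarrow> CL_formula \<tau> \<phi>"
| "CL_formula \<tau> (InfQ x \<phi>) \<longleftrightarrow> CL_formula \<tau> \<phi>"

primrec lattice_free :: "('f, 'r, 'c) fm \<Rightarrow> bool" where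
  "lattice_free (Num r) \<longleftrightarrow> True"
| "lattice_free (Rel R ts) \<longleftrightarrow> True"
| "lattice_free (Scale r \<phi>) \<longleftrightarrow> lattice_free \<phi>"
| "lattice_free (Add \<phi> \<psi>) \<longleftrightarrow> lattice_free \<phi> \<and> lattice_free \<psi>"
| "lattice_free (And \<phi> \<psi>) \<longleftrightarrow> False"
| "lattice_free (Or \<phi> \<psi>) \<longleftrightarrow> False"
| "lattice_free (SupQ x \<phi>) \<longleftrightarrow> lattice_free \<phi>"
| "lattice_free (InfQ x \<phi>) \<longleftrightarrow> lattice_free \<phi>"

definition linear_formula :: "('f, 'r, 'c) signature \<Rightarrow> ('f, 'r, 'c) fm \<Rightarrow> bool" where
  "linear_formula \<tau> \<phi> \<longleftrightarrow> CL_formula \<tau> \<phi> \<and> lattice_free \<phi>"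

primrec vars :: "('f, 'c) trm \<Rightarrow> nat set" where
  "vars (Var x) = {x}"
| "vars (Cst c) = {}"
| "vars (App F ts) = \<Union> (set (map vars ts))"

primrec fv :: "('f, 'r, 'c) fm \<Rightarrow> nat set" where
  "fv (Num r) = {}"
| "fv (Rel R ts) = \<Union> (vars ` set ts)"
| "fv (Scale r \<phi>) = fv \<phi>"
| "fv (Add \<phi> \<psi>) = fv \<phi> \<union> fv \<psi>"
| "fv (And \<phi> \<psi>) = fv \<phi> \<union> fv \<psi>"
| "fv (Or \<phi> \<psi>) = fv \<phi> \<union> fv \<psi>"
| "fv (SupQ x \<phi>) = fv \<phi> - {x}"
| "fv (InfQ x \<phi>) = fv \<phi> - {x}"

primrec teval :: "('f, 'r, 'c, 'a) lstruct \<Rightarrow> (nat \<Rightarrow> 'a) \<Rightarrow> ('f, 'c) trm \<Rightarrow> 'a" where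
  "teval M s (Var x) = s x"
| "teval M s (Cst c) = constI M c"
| "teval M s (App F ts) = funI M F (map (teval M s) ts)"

primrec eval :: "('f, 'r, 'c, 'a) lstruct \<Rightarrow> (nat \<Rightarrow> 'a) \<Rightarrow> ('f, 'r, 'c) fm \<Rightarrow> real" where
  "eval M s (Num r) = r"
| "eval M s (Rel R ts) = relI M R (map (teval M s) ts)"
| "eval M s (Scale r \<phi>) = r * eval M s \<phi>"
| "eval M s (Add \<phi> \<psi>) = eval M s \<phi> + eval M s \<psi>"
| "eval M s (And \<phi> \<psi>) = min (eval M s \<phi>) (eval M s \<psi>)"
| "eval M s (Or \<phi> \<psi>) = max (eval M s \<phi>) (eval M s \<psi>)"
| "eval M s (SupQ x \<phi>) = (SUP a\<in>univ M. eval M (s(x := a)) \<phi>)"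
| "eval M s (InfQ x \<phi>) = (INF a\<in>univ M. eval M (s(x := a)) \<phi>)"

text \<open>
  The value of a formula with free variables among \<open>0, \<dots>, n - 1\<close> at a tuple \<open>xs\<close> of length \<open>n\<close>,
  the \<open>i\<close>-th variable being assigned \<open>xs ! i\<close>; the assignment to the remaining variables is
  irrelevant. In particular a sentence is evaluated at the empty tuple.
\<close>

definition val :: "('f, 'r, 'c, 'a) lstruct \<Rightarrow> 'a list \<Rightarrow> ('f, 'r, 'c) fm \<Rightarrow> real" where
  "val M xs \<phi> = eval M ((!) xs) \<phi>"

definition lin_equiv ::
  "('f, 'r, 'c) signature \<Rightarrow> ('f, 'r, 'c, 'a) lstruct \<Rightarrow> ('f, 'r, 'c, 'b) lstruct \<Rightarrow> bool" where
  "lin_equiv \<tau> M N \<longleftrightarrow>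
     (\<forall>\<sigma>. linear_formula \<tau> \<sigma> \<and> fv \<sigma> = {} \<longrightarrow> val M [] \<sigma> = val N [] \<sigma>)"

definition CL_equiv ::
  "('f, 'r, 'c) signature \<Rightarrow> ('f, 'r, 'c, 'a) lstruct \<Rightarrow> ('f, 'r, 'c, 'b) lstruct \<Rightarrow> bool" where
  "CL_equiv \<tau> M N \<longleftrightarrow>
     (\<forall>\<sigma>. CL_formula \<tau> \<sigma> \<and> fv \<sigma> = {} \<longrightarrow> val M [] \<sigma> = val N [] \<sigma>)"


section \<open>Linear types and saturation\<close>

text \<open>The pair \<open>(\<phi>, \<psi>)\<close> stands for the condition \<open>\<phi> \<le> \<psi>\<close>.\<close>

type_synonym ('f, 'r, 'c) cond = "('f, 'r, 'c) fm \<times> ('f, 'r, 'c) fm"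

definition lin_conds :: "('f, 'r, 'c) signature \<Rightarrow> nat \<Rightarrow> ('f, 'r, 'c) cond set" where
  "lin_conds \<tau> n = {(\<phi>, \<psi>). linear_formula \<tau> \<phi> \<and> linear_formula \<tau> \<psi> \<and>
                             fv \<phi> \<subseteq> {..<n} \<and> fv \<psi> \<subseteq> {..<n}}"

definition satisfies :: "('f, 'r, 'c, 'a) lstruct \<Rightarrow> 'a list \<Rightarrow> ('f, 'r, 'c) cond set \<Rightarrow> bool" where
  "satisfies M xs p \<longleftrightarrow> (\<forall>(\<phi>, \<psi>)\<in>p. val M xs \<phi> \<le> val M xs \<psi>)"

text \<open>
  Parameters from \<open>A\<close> are the new constant symbols \<open>Inr a\<close>, \<open>a \<in> A\<close>, of the signature \<open>\<tau>(A)\<close>;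
  in \<open>M\<close> itself they name themselves, whereas a model of \<open>T\<^sub>A\<close> may interpret them freely.
\<close>

definition expand_sig :: "('f, 'r, 'c) signature \<Rightarrow> 'a set \<Rightarrow> ('f, 'r, 'c + 'a) signature" where
  "expand_sig \<tau> A =
     \<lparr>fsyms = fsyms \<tau>, rsyms = rsyms \<tau>, csyms = csyms \<tau> <+> A,
      farity = farity \<tau>, rarity = rarity \<tau>, fmod = fmod \<tau>, rmod = rmod \<tau>,
      rbound = rbound \<tau>, dsym = dsym \<tau>\<rparr>"

definition expand :: "('f, 'r, 'c, 'a) lstruct \<Rightarrow> ('f, 'r, 'c + 'a, 'a) lstruct" where
  "expand M = \<lparr>univ = univ M, funI = funI M, relI = relI M, constI = case_sum (constI M) id\<rparr>"

definition lin_theory ::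
  "('f, 'r, 'c) signature \<Rightarrow> ('f, 'r, 'c, 'a) lstruct \<Rightarrow> 'a set \<Rightarrow> ('f, 'r, 'c + 'a) cond set" where
  "lin_theory \<tau> M A = {c \<in> lin_conds (expand_sig \<tau> A) 0. satisfies (expand M) [] {c}}"

text \<open>
  \<open>T\<^sub>A \<union> p(x\<^sub>0, \<dots>, x\<^sub>n\<^sub>-\<^sub>1)\<close> is satisfied by some tuple in some model of \<open>T\<^sub>A\<close>. In HOL the models
  must be taken from a fixed type. The (infinite) type of formulas with parameters is large
  enough for this to lose nothing: by the downward Loewenheim-Skolem theorem (close the given tuple
  and the constants under the function symbols and under approximate witnesses for the quantifiers
  \<open>sup\<close>, \<open>inf\<close>), a tuple in an arbitrary model of \<open>T\<^sub>A\<close> lies in a substructure, with the same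
  values of linear formulas, whose cardinality is at most that of the set of formulas.
  Structures need not be complete, so no completion is needed.
\<close>

definition lin_satisfiable ::
  "('f, 'r, 'c) signature \<Rightarrow> ('f, 'r, 'c, 'a) lstruct \<Rightarrow> 'a set \<Rightarrow> nat \<Rightarrow>
   ('f, 'r, 'c + 'a) cond set \<Rightarrow> bool" where
  "lin_satisfiable \<tau> M A n p \<longleftrightarrow>
     (\<exists>K :: ('f, 'r, 'c + 'a, ('f, 'r, 'c + 'a) fm) lstruct.
        is_structure (expand_sig \<tau> A) K \<and> satisfies K [] (lin_theory \<tau> M A) \<and>
        (\<exists>xs\<in>tuples (univ K) n. satisfies K xs (lin_theory \<tau> M A \<union> p)))"

definition lin_types ::
  "('f, 'r, 'c) signature \<Rightarrow> ('f, 'r, 'c, 'a) lstruct \<Rightarrow> 'a set \<Rightarrow> nat \<Rightarrow>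
   ('f, 'r, 'c + 'a) cond set set" where
  "lin_types \<tau> M A n =
     {p. p \<subseteq> lin_conds (expand_sig \<tau> A) n \<and> lin_satisfiable \<tau> M A n p \<and>
         (\<forall>q. p \<subseteq> q \<and> q \<subseteq> lin_conds (expand_sig \<tau> A) n \<and> lin_satisfiable \<tau> M A n q \<longrightarrow> q = p)}"

definition realized ::
  "('f, 'r, 'c, 'a) lstruct \<Rightarrow> nat \<Rightarrow> ('f, 'r, 'c + 'a) cond set \<Rightarrow> bool" where
  "realized M n p \<longleftrightarrow> (\<exists>xs\<in>tuples (univ M) n. satisfies (expand M) xs p)"

text \<open>The cardinal \<open>\<kappa>\<close> is given as a cardinal order in the sense of the library; \<open>natLeq\<close> is \<open>\<aleph>\<^sub>0\<close>.\<close>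

definition lin_saturated ::
  "'k rel \<Rightarrow> ('f, 'r, 'c) signature \<Rightarrow> ('f, 'r, 'c, 'a) lstruct \<Rightarrow> bool" where
  "lin_saturated \<kappa> \<tau> M \<longleftrightarrow>
     (\<forall>A. A \<subseteq> univ M \<and> |A| <o \<kappa> \<longrightarrow> (\<forall>p\<in>lin_types \<tau> M A 1. realized M 1 p))"

end

theory Submission
  imports Defs
begin

text \<open>
  Finite matchings between \<open>M\<close> and \<open>N\<close> that preserve linear formulas form a back-and-forth system.
  Given a matching \<open>a \<mapsto> b\<close> and \<open>c \<in> M\<close>, naming \<open>a\<close> in \<open>M\<close> by the parameters \<open>b\<close> gives a model of the linear
  theory of \<open>(N, b)\<close> in which \<open>c\<close> realizes a linear type over \<open>b\<close>. This type is maximal, since it fixes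
  the value of every linear formula, so saturation of \<open>N\<close> realizes it. Hence a sup or inf ranges
  over the same set of values on both sides, and no continuity of \<open>\<and>\<close>, \<open>\<or>\<close> is needed. The
  Loewenheim-Skolem theorem enters only because models of the type must live on the type of formulas.
\<close>

section \<open>Evaluation of terms and formulas\<close>

lemma teval_cong: "(\<And>i. i \<in> vars t \<Longrightarrow> s i = s' i) \<Longrightarrow> teval M s t = teval M s' t"
proof (induction t)
  case (App F ts)
  then have eq: "map (teval M s) ts = map (teval M s') ts" by (intro map_cong) auto
  show ?case by (simp add: eq)
qed auto

lemma eval_cong: "(\<And>i. i \<in> fv \<phi> \<Longrightarrow> s i = s' i) \<Longrightarrow> eval M s \<phi> = eval M s' \<phi>"
proof (induction \<phi> arbitrary: s s')
  case (Rel R ts)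
  then have eq: "map (teval M s) ts = map (teval M s') ts"
    by (intro map_cong teval_cong) auto
  show ?case by (simp add: eq)
next
  case (Add \<phi> \<psi>)
  have "eval M s \<phi> = eval M s' \<phi>" "eval M s \<psi> = eval M s' \<psi>"
    by (rule Add.IH, simp add: Add.prems)+
  then show ?case by simp
next
  case (And \<phi> \<psi>)
  have "eval M s \<phi> = eval M s' \<phi>" "eval M s \<psi> = eval M s' \<psi>"
    by (rule And.IH, simp add: And.prems)+
  then show ?case by simp
next
  case (Or \<phi> \<psi>)
  have "eval M s \<phi> = eval M s' \<phi>" "eval M s \<psi> = eval M s' \<psi>"
    by (rule Or.IH, simp add: Or.prems)+
  then show ?case by simp
next
  case (SupQ x \<phi>)
  have "eval M (s(x := a)) \<phi> = eval M (s'(x := a)) \<phi>" for a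
    by (rule SupQ.IH) (simp add: SupQ.prems)
  then show ?case by simp
next
  case (InfQ x \<phi>)
  have "eval M (s(x := a)) \<phi> = eval M (s'(x := a)) \<phi>" for a
    by (rule InfQ.IH) (simp add: InfQ.prems)
  then show ?case by simp
next
  case (Scale r \<phi>)
  have "eval M s \<phi> = eval M s' \<phi>"
    by (rule Scale.IH) (simp add: Scale.prems)
  then show ?case by simp
qed simp

lemma teval_in_univ:
  assumes "is_structure \<tau> M" "\<And>i. s i \<in> univ M"
  shows "wf_trm \<tau> t \<Longrightarrow> teval M s t \<in> univ M"
proof (induction t)
  case (App F ts)
  then have "map (teval M s) ts \<in> tuples (univ M) (farity \<tau> F)"
    by (auto simp: tuples_def list_all_iff)
  then show ?case using assms(1) App.prems by (auto simp: is_structure_def)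
qed (use assms in \<open>auto simp: is_structure_def\<close>)

text \<open>Real suprema and infima carry information only over bounded sets. The bound depends on
  the formula and the structure but not on the assignment, so it passes through quantifiers
  unchanged.\<close>

lemma eval_bounded:
  assumes "is_structure \<tau> M"
  shows "CL_formula \<tau> \<phi> \<Longrightarrow> \<exists>C. \<forall>s. range s \<subseteq> univ M \<longrightarrow> \<bar>eval M s \<phi>\<bar> \<le> C"
proof (induction \<phi>)
  case (Rel R ts)
  have "\<bar>relI M R (map (teval M s) ts)\<bar> \<le> rbound \<tau> R" if s: "range s \<subseteq> univ M" for s
  proof -
    have "teval M s t \<in> univ M" if "t \<in> set ts" for t
      using that Rel teval_in_univ[OF assms, of s t] s by (auto simp: list_all_iff)
    then have "map (teval M s) ts \<in> tuples (univ M) (rarity \<tau> R)"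
      using Rel by (auto simp: tuples_def)
    then show ?thesis using assms Rel by (auto simp: is_structure_def)
  qed
  then show ?case by auto
next
  case (Scale r \<phi>)
  then obtain C where C: "\<And>s. range s \<subseteq> univ M \<Longrightarrow> \<bar>eval M s \<phi>\<bar> \<le> C" by auto
  show ?case
    by (rule exI[of _ "\<bar>r\<bar> * C"]) (auto simp: abs_mult intro!: mult_left_mono C)
next
  case (Add \<phi> \<psi>)
  then obtain C D where CD: "\<And>s. range s \<subseteq> univ M \<Longrightarrow> \<bar>eval M s \<phi>\<bar> \<le> C"
    "\<And>s. range s \<subseteq> univ M \<Longrightarrow> \<bar>eval M s \<psi>\<bar> \<le> D" by auto
  have "\<bar>eval M s \<phi> + eval M s \<psi>\<bar> \<le> C + D" if "range s \<subseteq> univ M" for s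
    using CD[OF that] by linarith
  then show ?case by auto
next
  case (And \<phi> \<psi>)
  then obtain C D where CD: "\<And>s. range s \<subseteq> univ M \<Longrightarrow> \<bar>eval M s \<phi>\<bar> \<le> C"
    "\<And>s. range s \<subseteq> univ M \<Longrightarrow> \<bar>eval M s \<psi>\<bar> \<le> D" by auto
  have "\<bar>min (eval M s \<phi>) (eval M s \<psi>)\<bar> \<le> max C D" if "range s \<subseteq> univ M" for s
    using CD[OF that] by linarith
  then show ?case by auto
next
  case (Or \<phi> \<psi>)
  then obtain C D where CD: "\<And>s. range s \<subseteq> univ M \<Longrightarrow> \<bar>eval M s \<phi>\<bar> \<le> C"
    "\<And>s. range s \<subseteq> univ M \<Longrightarrow> \<bar>eval M s \<psi>\<bar> \<le> D" by auto
  have "\<bar>max (eval M s \<phi>) (eval M s \<psi>)\<bar> \<le> max C D" if "range s \<subseteq> univ M" for s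
    using CD[OF that] by linarith
  then show ?case by auto
next
  case (SupQ x \<phi>)
  then obtain C where C: "\<And>s. range s \<subseteq> univ M \<Longrightarrow> \<bar>eval M s \<phi>\<bar> \<le> C" by auto
  have "univ M \<noteq> {}" using assms by (simp add: is_structure_def)
  moreover have "\<bar>eval M (s(x := a)) \<phi>\<bar> \<le> C" if "range s \<subseteq> univ M" "a \<in> univ M" for s a
    using that by (intro C) auto
  ultimately show ?case
    by (intro exI[of _ C]) (auto intro!: cSup_abs_le)
next
  case (InfQ x \<phi>)
  then obtain C where C: "\<And>s. range s \<subseteq> univ M \<Longrightarrow> \<bar>eval M s \<phi>\<bar> \<le> C" by auto
  have "univ M \<noteq> {}" using assms by (simp add: is_structure_def)
  moreover have "\<bar>eval M (s(x := a)) \<phi>\<bar> \<le> C" if "range s \<subseteq> univ M" "a \<in> univ M" for s a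
    using that by (intro C) auto
  ultimately show ?case
    by (intro exI[of _ C]) (auto intro!: cInf_abs_ge)
qed auto

lemma eval_update_bounded:
  assumes "is_structure \<tau> M" "CL_formula \<tau> \<phi>" "range s \<subseteq> univ M"
  shows "bounded ((\<lambda>a. eval M (s(x := a)) \<phi>) ` univ M)"
proof -
  obtain C where C: "\<And>s. range s \<subseteq> univ M \<Longrightarrow> \<bar>eval M s \<phi>\<bar> \<le> C"
    using eval_bounded[OF assms(1,2)] by auto
  have "\<bar>eval M (s(x := a)) \<phi>\<bar> \<le> C" if "a \<in> univ M" for a
    using that assms(3) by (intro C) auto
  then show ?thesis by (auto simp: bounded_iff)
qed


section \<open>Substitution\<close>

text \<open>
  Terms are substituted for constants and variables at once. The bound variable \<open>x\<close> becomes \<open>h x\<close>,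
  so there is no capture as long as the substituted terms avoid the range of \<open>h\<close>.
\<close>

primrec subst_trm :: "('c \<Rightarrow> ('f, 'd) trm) \<Rightarrow> (nat \<Rightarrow> ('f, 'd) trm) \<Rightarrow> ('f, 'c) trm \<Rightarrow> ('f, 'd) trm" where
  "subst_trm \<kappa> \<sigma> (Var x) = \<sigma> x"
| "subst_trm \<kappa> \<sigma> (Cst c) = \<kappa> c"
| "subst_trm \<kappa> \<sigma> (App F ts) = App F (map (subst_trm \<kappa> \<sigma>) ts)"

primrec subst_fm ::
  "('c \<Rightarrow> ('f, 'd) trm) \<Rightarrow> (nat \<Rightarrow> nat) \<Rightarrow> (nat \<Rightarrow> ('f, 'd) trm) \<Rightarrow> ('f, 'r, 'c) fm \<Rightarrow> ('f, 'r, 'd) fm" where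
  "subst_fm \<kappa> h \<sigma> (Num r) = Num r"
| "subst_fm \<kappa> h \<sigma> (Rel R ts) = Rel R (map (subst_trm \<kappa> \<sigma>) ts)"
| "subst_fm \<kappa> h \<sigma> (Scale r \<phi>) = Scale r (subst_fm \<kappa> h \<sigma> \<phi>)"
| "subst_fm \<kappa> h \<sigma> (Add \<phi> \<psi>) = Add (subst_fm \<kappa> h \<sigma> \<phi>) (subst_fm \<kappa> h \<sigma> \<psi>)"
| "subst_fm \<kappa> h \<sigma> (And \<phi> \<psi>) = And (subst_fm \<kappa> h \<sigma> \<phi>) (subst_fm \<kappa> h \<sigma> \<psi>)"
| "subst_fm \<kappa> h \<sigma> (Or \<phi> \<psi>) = Or (subst_fm \<kappa> h \<sigma> \<phi>) (subst_fm \<kappa> h \<sigma> \<psi>)"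
| "subst_fm \<kappa> h \<sigma> (SupQ x \<phi>) = SupQ (h x) (subst_fm \<kappa> h (\<sigma>(x := Var (h x))) \<phi>)"
| "subst_fm \<kappa> h \<sigma> (InfQ x \<phi>) = InfQ (h x) (subst_fm \<kappa> h (\<sigma>(x := Var (h x))) \<phi>)"

lemma wf_subst_trm:
  assumes "fsyms \<tau> = fsyms \<tau>'" "farity \<tau> = farity \<tau>'"
    and "\<And>c. c \<in> csyms \<tau> \<Longrightarrow> wf_trm \<tau>' (\<kappa> c)" and "\<And>x. wf_trm \<tau>' (\<sigma> x)"
  shows "wf_trm \<tau> t \<Longrightarrow> wf_trm \<tau>' (subst_trm \<kappa> \<sigma> t)"
  by (induction t) (use assms in \<open>auto simp: list_all_iff\<close>)

lemma linear_subst_fm: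
  assumes "fsyms \<tau> = fsyms \<tau>'" "farity \<tau> = farity \<tau>'" "rsyms \<tau> = rsyms \<tau>'" "rarity \<tau> = rarity \<tau>'"
    and "\<And>c. c \<in> csyms \<tau> \<Longrightarrow> wf_trm \<tau>' (\<kappa> c)" and "\<And>x. wf_trm \<tau>' (\<sigma> x)"
  shows "linear_formula \<tau> \<phi> \<Longrightarrow> linear_formula \<tau>' (subst_fm \<kappa> h \<sigma> \<phi>)"
  using assms(6)
proof (induction \<phi> arbitrary: \<sigma>)
  case (Rel R ts)
  then show ?case
    using assms(3,4) wf_subst_trm[OF assms(1,2,5) Rel.prems(2)]
    by (auto simp: linear_formula_def list_all_iff)
qed (auto simp: linear_formula_def)

lemma vars_subst_trm:
  "wf_trm \<tau> t \<Longrightarrow>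
    vars (subst_trm \<kappa> \<sigma> t) \<subseteq> (\<Union>x\<in>vars t. vars (\<sigma> x)) \<union> (\<Union>c\<in>csyms \<tau>. vars (\<kappa> c))"
proof (induction t)
  case (App F ts)
  then show ?case by (fastforce simp: list_all_iff)
qed auto

text \<open>Under a quantifier the entry for \<open>x\<close> becomes \<open>Var (h x)\<close>, and
  the new quantifier removes exactly this variable again. So only terms put in for free variables
  and for constants contribute.\<close>

lemma fv_subst_fm:
  "CL_formula \<tau> \<phi> \<Longrightarrow>
    fv (subst_fm \<kappa> h \<sigma> \<phi>) \<subseteq> (\<Union>x\<in>fv \<phi>. vars (\<sigma> x)) \<union> (\<Union>c\<in>csyms \<tau>. vars (\<kappa> c))"
proof (induction \<phi> arbitrary: \<sigma>)
  case (Rel R ts)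
  then have "vars (subst_trm \<kappa> \<sigma> t) \<subseteq> (\<Union>x\<in>vars t. vars (\<sigma> x)) \<union> (\<Union>c\<in>csyms \<tau>. vars (\<kappa> c))"
    if "t \<in> set ts" for t
    using that by (intro vars_subst_trm) (auto simp: list_all_iff)
  then show ?case by fastforce
next
  case (Add \<phi> \<psi>)
  then show ?case using Add.IH[of \<sigma>] by fastforce
next
  case (And \<phi> \<psi>)
  then show ?case using And.IH[of \<sigma>] by fastforce
next
  case (Or \<phi> \<psi>)
  then show ?case using Or.IH[of \<sigma>] by fastforce
next
  case (SupQ x \<phi>)
  then show ?case using SupQ.IH[of "\<sigma>(x := Var (h x))"] by (fastforce split: if_splits)
next
  case (InfQ x \<phi>)
  then show ?case using InfQ.IH[of "\<sigma>(x := Var (h x))"] by (fastforce split: if_splits)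
qed auto

lemma teval_subst_trm:
  assumes "funI M' = funI M"
    and "\<And>c. c \<in> csyms \<tau> \<Longrightarrow> teval M' s' (\<kappa> c) = constI M c"
  shows "wf_trm \<tau> t \<Longrightarrow> (\<And>x. x \<in> vars t \<Longrightarrow> teval M' s' (\<sigma> x) = s x) \<Longrightarrow>
    teval M' s' (subst_trm \<kappa> \<sigma> t) = teval M s t"
proof (induction t)
  case (App F ts)
  then have eq: "map (teval M' s' \<circ> subst_trm \<kappa> \<sigma>) ts = map (teval M s) ts"
    by (auto simp: list_all_iff)
  show ?case using assms(1) by (simp add: eq)
qed (use assms in auto)

text \<open>Passing under a quantifier changes \<open>s'\<close> only at \<open>h x\<close>. For
  \<open>y\<close> other than \<open>x\<close> this variable does not occur in
  \<open>\<sigma> y\<close>, which is either \<open>Var (h y)\<close> with \<open>h\<close>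
  injective or a term that avoids \<open>range h\<close>.\<close>

lemma teval_subst_update:
  assumes "inj h" and \<sigma>: "\<sigma> y = Var (h y) \<or> vars (\<sigma> y) \<inter> range h = {}"
    and "y \<noteq> x \<Longrightarrow> teval M s' (\<sigma> y) = s y"
  shows "teval M (s'(h x := a)) ((\<sigma>(x := Var (h x))) y) = (s(x := a)) y"
proof (cases "y = x")
  case False
  have "h x \<notin> vars (\<sigma> y)"
    using \<sigma>
  proof
    assume "\<sigma> y = Var (h y)"
    then show ?thesis using False injD[OF assms(1), of x y] by auto
  qed blast
  then have "teval M (s'(h x := a)) (\<sigma> y) = teval M s' (\<sigma> y)"
    by (intro teval_cong) auto
  then show ?thesis using False assms(3) by simp
qed simp

text \<open>\<open>M\<close> and \<open>M'\<close> may differ in their constants; a constant of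
  \<open>M\<close> is simulated by a term evaluated in \<open>M'\<close>. The alternative for
  \<open>\<sigma> x\<close> is an invariant of the induction: a quantifier puts in
  \<open>Var (h x)\<close>, which is of the first kind, and leaves all other entries alone.\<close>

lemma eval_subst_fm:
  assumes same: "univ M' = univ M" "funI M' = funI M" "relI M' = relI M"
    and h: "inj h" "\<And>c. c \<in> csyms \<tau> \<Longrightarrow> vars (\<kappa> c) \<inter> range h = {}"
  shows "CL_formula \<tau> \<phi> \<Longrightarrow>
    (\<And>c. c \<in> csyms \<tau> \<Longrightarrow> teval M' s' (\<kappa> c) = constI M c) \<Longrightarrow>
    (\<And>x. \<sigma> x = Var (h x) \<or> vars (\<sigma> x) \<inter> range h = {}) \<Longrightarrow>
    (\<And>x. x \<in> fv \<phi> \<Longrightarrow> teval M' s' (\<sigma> x) = s x) \<Longrightarrow>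
    eval M' s' (subst_fm \<kappa> h \<sigma> \<phi>) = eval M s \<phi>"
proof (induction \<phi> arbitrary: \<sigma> s s')
  case (Rel R ts)
  have "teval M' s' (subst_trm \<kappa> \<sigma> t) = teval M s t" if "t \<in> set ts" for t
    by (rule teval_subst_trm[OF same(2) Rel.prems(2)])
      (use Rel.prems(1,4) that in \<open>auto simp: list_all_iff\<close>)
  then have eq: "map (teval M' s' \<circ> subst_trm \<kappa> \<sigma>) ts = map (teval M s) ts"
    by (intro map_cong) auto
  show ?case using same by (simp add: eq)
next
  case (Scale r \<phi>)
  then show ?case using Scale.IH[of s' \<sigma> s] by simp
next
  case (Add \<phi> \<psi>)
  then show ?case using Add.IH[of s' \<sigma> s] by simp
next
  case (And \<phi> \<psi>)
  then show ?case using And.IH[of s' \<sigma> s] by simp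
next
  case (Or \<phi> \<psi>)
  then show ?case using Or.IH[of s' \<sigma> s] by simp
next
  case (SupQ x \<phi>)
  have "eval M' (s'(h x := a)) (subst_fm \<kappa> h (\<sigma>(x := Var (h x))) \<phi>) = eval M (s(x := a)) \<phi>" for a
  proof (rule SupQ.IH)
    show "CL_formula \<tau> \<phi>" using SupQ.prems(1) by simp
    show "teval M' (s'(h x := a)) (\<kappa> c) = constI M c" if "c \<in> csyms \<tau>" for c
    proof -
      have "teval M' (s'(h x := a)) (\<kappa> c) = teval M' s' (\<kappa> c)"
        using h(2)[OF that] by (intro teval_cong) auto
      then show ?thesis using SupQ.prems(2)[OF that] by simp
    qed
    show "(\<sigma>(x := Var (h x))) y = Var (h y) \<or> vars ((\<sigma>(x := Var (h x))) y) \<inter> range h = {}" for y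
      using SupQ.prems(3)[of y] by simp
    show "teval M' (s'(h x := a)) ((\<sigma>(x := Var (h x))) y) = (s(x := a)) y" if "y \<in> fv \<phi>" for y
      using that SupQ.prems(4)[of y] by (intro teval_subst_update h(1) SupQ.prems(3)) simp
  qed
  then show ?case using same by simp
next
  case (InfQ x \<phi>)
  have "eval M' (s'(h x := a)) (subst_fm \<kappa> h (\<sigma>(x := Var (h x))) \<phi>) = eval M (s(x := a)) \<phi>" for a
  proof (rule InfQ.IH)
    show "CL_formula \<tau> \<phi>" using InfQ.prems(1) by simp
    show "teval M' (s'(h x := a)) (\<kappa> c) = constI M c" if "c \<in> csyms \<tau>" for c
    proof -
      have "teval M' (s'(h x := a)) (\<kappa> c) = teval M' s' (\<kappa> c)"
        using h(2)[OF that] by (intro teval_cong) auto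
      then show ?thesis using InfQ.prems(2)[OF that] by simp
    qed
    show "(\<sigma>(x := Var (h x))) y = Var (h y) \<or> vars ((\<sigma>(x := Var (h x))) y) \<inter> range h = {}" for y
      using InfQ.prems(3)[of y] by simp
    show "teval M' (s'(h x := a)) ((\<sigma>(x := Var (h x))) y) = (s(x := a)) y" if "y \<in> fv \<phi>" for y
      using that InfQ.prems(4)[of y] by (intro teval_subst_update h(1) InfQ.prems(3)) simp
  qed
  then show ?case using same by simp
qed auto


section \<open>Downward Loewenheim-Skolem\<close>

text \<open>Used with \<open>A\<close> the small universe and \<open>V\<close> the large one. The
  values of \<open>F\<close> are among those of \<open>G\<close>, which gives one inequality; the
  other holds up to every positive \<open>e\<close>.\<close>

lemma SUP_eq_approx:
  fixes F :: "'x \<Rightarrow> real" and G :: "'y \<Rightarrow> real"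
  assumes "A \<noteq> {}" "bdd_above (G ` V)" "F ` A \<subseteq> G ` V"
    and approx: "\<And>v e. v \<in> V \<Longrightarrow> 0 < e \<Longrightarrow> \<exists>u\<in>A. G v \<le> F u + e"
  shows "(SUP u\<in>A. F u) = (SUP v\<in>V. G v)"
proof (rule antisym)
  have bdd: "bdd_above (F ` A)" using assms(2,3) by (rule bdd_above_mono)
  show "(SUP u\<in>A. F u) \<le> (SUP v\<in>V. G v)"
    using assms by (intro cSup_subset_mono) auto
  have "G v \<le> (SUP u\<in>A. F u)" if v: "v \<in> V" for v
  proof (rule field_le_epsilon)
    fix e :: real assume "0 < e"
    then obtain u where "u \<in> A" "G v \<le> F u + e" using approx[OF v] by blast
    then show "G v \<le> (SUP u\<in>A. F u) + e" using cSUP_upper[OF _ bdd, of u] by linarith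
  qed
  moreover have "V \<noteq> {}" using assms by auto
  ultimately show "(SUP v\<in>V. G v) \<le> (SUP u\<in>A. F u)" by (intro cSUP_least)
qed

lemma INF_eq_approx:
  fixes F :: "'x \<Rightarrow> real" and G :: "'y \<Rightarrow> real"
  assumes "A \<noteq> {}" "bdd_below (G ` V)" "F ` A \<subseteq> G ` V"
    and approx: "\<And>v e. v \<in> V \<Longrightarrow> 0 < e \<Longrightarrow> \<exists>u\<in>A. F u \<le> G v + e"
  shows "(INF u\<in>A. F u) = (INF v\<in>V. G v)"
proof -
  have "(SUP u\<in>A. - F u) = (SUP v\<in>V. - G v)"
  proof (rule SUP_eq_approx)
    show "bdd_above ((\<lambda>v. - G v) ` V)"
      using assms(2) by (simp add: image_image flip: bdd_below_uminus)
    show "\<exists>u\<in>A. - G v \<le> - F u + e" if "v \<in> V" "0 < e" for v e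
      using approx[OF that] by (auto simp: algebra_simps)
    show "(\<lambda>u. - F u) ` A \<subseteq> (\<lambda>v. - G v) ` V"
      using image_mono[OF assms(3), of uminus] by (simp add: image_image)
  qed (fact assms(1))
  then show ?thesis by (simp add: Inf_real_def image_image)
qed

text \<open>This is the Tarski-Vaught test with an error: a real supremum may not be attained, but
  witnesses up to every positive \<open>e\<close> already give it the same value in the smaller
  structure.\<close>

lemma eval_embedding:
  fixes j :: "'k \<Rightarrow> 'a"
  assumes K: "is_structure \<tau> K" and M: "is_structure \<tau> M"
    and j: "\<And>a. a \<in> univ K \<Longrightarrow> j a \<in> univ M"
    and hom_const: "\<And>c. c \<in> csyms \<tau> \<Longrightarrow> j (constI K c) = constI M c"
    and hom_fun: "\<And>F xs. F \<in> fsyms \<tau> \<Longrightarrow> xs \<in> tuples (univ K) (farity \<tau> F) \<Longrightarrow>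
      j (funI K F xs) = funI M F (map j xs)"
    and hom_rel: "\<And>R xs. R \<in> rsyms \<tau> \<Longrightarrow> xs \<in> tuples (univ K) (rarity \<tau> R) \<Longrightarrow>
      relI K R xs = relI M R (map j xs)"
    and tarski_vaught: "\<And>\<phi> x s a e. CL_formula \<tau> \<phi> \<Longrightarrow> range s \<subseteq> univ K \<Longrightarrow> a \<in> univ M \<Longrightarrow> 0 < e \<Longrightarrow>
      \<exists>u\<in>univ K. eval M ((j \<circ> s)(x := a)) \<phi> \<le> eval M ((j \<circ> s)(x := j u)) \<phi> + e"
  shows "CL_formula \<tau> \<phi> \<Longrightarrow> range s \<subseteq> univ K \<Longrightarrow> eval K s \<phi> = eval M (j \<circ> s) \<phi>"
proof (induction \<phi> arbitrary: s)
  have trm: "j (teval K s t) = teval M (j \<circ> s) t" if "wf_trm \<tau> t" "range s \<subseteq> univ K" for t s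
    using that
  proof (induction t)
    case (App F ts)
    then have "map (teval K s) ts \<in> tuples (univ K) (farity \<tau> F)"
      by (auto simp: tuples_def list_all_iff intro!: teval_in_univ[OF K])
    moreover have "j (teval K s t) = teval M (j \<circ> s) t" if "t \<in> set ts" for t
      using App.IH[OF that] App.prems that by (simp add: list_all_iff o_def)
    then have eq: "map (j \<circ> teval K s) ts = map (teval M (j \<circ> s)) ts"
      by (intro map_cong) auto
    ultimately have "j (teval K s (App F ts)) = funI M F (map j (map (teval K s) ts))"
      using App.prems(1) hom_fun by simp
    then show ?case by (simp only: teval.simps map_map eq)
  qed (use hom_const in auto)
  case (Rel R ts)
  then have "map (teval K s) ts \<in> tuples (univ K) (rarity \<tau> R)"
    by (auto simp: tuples_def list_all_iff intro!: teval_in_univ[OF K])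
  moreover have eq: "map (j \<circ> teval K s) ts = map (teval M (j \<circ> s)) ts"
    using Rel.prems trm by (intro map_cong) (auto simp: list_all_iff)
  ultimately have "eval K s (Rel R ts) = relI M R (map j (map (teval K s) ts))"
    using Rel.prems(1) hom_rel by simp
  then show ?case by (simp only: eval.simps map_map eq)
next
  case (SupQ x \<phi>)
  have ne: "univ K \<noteq> {}" using K by (simp add: is_structure_def)
  have js: "range (j \<circ> s) \<subseteq> univ M" using SupQ.prems j by auto
  have IH: "eval K (s(x := u)) \<phi> = eval M ((j \<circ> s)(x := j u)) \<phi>" if "u \<in> univ K" for u
  proof -
    have "range (s(x := u)) \<subseteq> univ K" using SupQ.prems(2) that by auto
    then show ?thesis using SupQ.IH[of "s(x := u)"] SupQ.prems(1) by (simp only: fun_upd_comp CL_formula.simps)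
  qed
  have "(SUP u\<in>univ K. eval K (s(x := u)) \<phi>) = (SUP a\<in>univ M. eval M ((j \<circ> s)(x := a)) \<phi>)"
  proof (rule SUP_eq_approx)
    show "bdd_above ((\<lambda>a. eval M ((j \<circ> s)(x := a)) \<phi>) ` univ M)"
      using SupQ.prems by (intro bounded_imp_bdd_above eval_update_bounded[OF M _ js]) simp
  next
    fix a and e :: real assume "a \<in> univ M" "0 < e"
    then show "\<exists>u\<in>univ K. eval M ((j \<circ> s)(x := a)) \<phi> \<le> eval K (s(x := u)) \<phi> + e"
      using tarski_vaught[of \<phi> s a e x] SupQ.prems IH by auto
  qed (use ne IH j in auto)
  then show ?case by (simp only: eval.simps)
next
  case (InfQ x \<phi>)
  have ne: "univ K \<noteq> {}" using K by (simp add: is_structure_def)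
  have js: "range (j \<circ> s) \<subseteq> univ M" using InfQ.prems j by auto
  have IH: "eval K (s(x := u)) \<phi> = eval M ((j \<circ> s)(x := j u)) \<phi>" if "u \<in> univ K" for u
  proof -
    have "range (s(x := u)) \<subseteq> univ K" using InfQ.prems(2) that by auto
    then show ?thesis using InfQ.IH[of "s(x := u)"] InfQ.prems(1) by (simp only: fun_upd_comp CL_formula.simps)
  qed
  have "(INF u\<in>univ K. eval K (s(x := u)) \<phi>) = (INF a\<in>univ M. eval M ((j \<circ> s)(x := a)) \<phi>)"
  proof (rule INF_eq_approx)
    show "bdd_below ((\<lambda>a. eval M ((j \<circ> s)(x := a)) \<phi>) ` univ M)"
      using InfQ.prems by (intro bounded_imp_bdd_below eval_update_bounded[OF M _ js]) simp
  next
    fix a and e :: real assume "a \<in> univ M" "0 < e"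
    \<comment> \<open>A witness for the supremum of \<open>Scale (- 1) \<phi>\<close> is one for the
      infimum of \<open>\<phi>\<close>.\<close>
    then show "\<exists>u\<in>univ K. eval K (s(x := u)) \<phi> \<le> eval M ((j \<circ> s)(x := a)) \<phi> + e"
      using tarski_vaught[of "Scale (- 1) \<phi>" s a e x] InfQ.prems IH by force
  qed (use ne IH j in auto)
  then show ?case by (simp only: eval.simps)
qed auto

text \<open>The metric interprets the relation symbol \<open>dsym \<tau>\<close>, so a map that
  preserves relations is an isometry, and moduli and bounds are inherited from \<open>M\<close>.
  Injectivity ensures that distinct points of \<open>K\<close> have nonzero distance.\<close>

lemma is_structure_pullback:
  fixes j :: "'k \<Rightarrow> 'a"
  assumes sig: "is_signature \<tau>" and M: "is_structure \<tau> M" and ne: "univ K \<noteq> {}"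
    and inj: "inj_on j (univ K)" and j: "\<And>a. a \<in> univ K \<Longrightarrow> j a \<in> univ M"
    and const: "\<And>c. c \<in> csyms \<tau> \<Longrightarrow> constI K c \<in> univ K"
    and funs: "\<And>F xs. F \<in> fsyms \<tau> \<Longrightarrow> xs \<in> tuples (univ K) (farity \<tau> F) \<Longrightarrow>
      funI K F xs \<in> univ K \<and> j (funI K F xs) = funI M F (map j xs)"
    and rels: "\<And>R xs. R \<in> rsyms \<tau> \<Longrightarrow> xs \<in> tuples (univ K) (rarity \<tau> R) \<Longrightarrow>
      relI K R xs = relI M R (map j xs)"
  shows "is_structure \<tau> K"
proof -
  interpret MS: Metric_space "univ M" "mdist \<tau> M" using M by (simp add: is_structure_def)
  have md: "mdist \<tau> K x y = mdist \<tau> M (j x) (j y)" if "x \<in> univ K" "y \<in> univ K" for x y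
    using that sig j rels[of "dsym \<tau>" "[x, y]"]
    by (simp add: mdist_def is_signature_def tuples_def)
  have "Metric_space (univ K) (mdist \<tau> K)"
  proof
    show "0 \<le> mdist \<tau> K x y" for x y
    proof (cases "x \<in> univ K \<and> y \<in> univ K")
      case True
      then show ?thesis using md[of x y] MS.nonneg by simp
    qed (auto simp: mdist_def)
    show "mdist \<tau> K x y = mdist \<tau> K y x" for x y
    proof (cases "x \<in> univ K \<and> y \<in> univ K")
      case True
      then show ?thesis using md[of x y] md[of y x] MS.commute by simp
    qed (auto simp: mdist_def)
    show "mdist \<tau> K x y = 0 \<longleftrightarrow> x = y" if "x \<in> univ K" "y \<in> univ K" for x y
      using that inj by (simp add: md j inj_on_eq_iff)
    show "mdist \<tau> K x z \<le> mdist \<tau> K x y + mdist \<tau> K y z"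
      if "x \<in> univ K" "y \<in> univ K" "z \<in> univ K" for x y z
      using that MS.triangle by (simp add: md j)
  qed
  moreover have tup: "map j xs \<in> tuples (univ M) n" if "xs \<in> tuples (univ K) n" for xs n
    using that j by (auto simp: tuples_def)
  moreover have td: "tdist \<tau> K xs ys = tdist \<tau> M (map j xs) (map j ys)"
    if "xs \<in> tuples (univ K) n" "ys \<in> tuples (univ K) n" for xs ys n
    using that by (auto simp: tdist_def tuples_def intro!: sum.cong md)
  have "lam_continuous (fmod \<tau> F) (tuples (univ K) (farity \<tau> F)) (tdist \<tau> K) (mdist \<tau> K) (funI K F)"
    if F: "F \<in> fsyms \<tau>" for F
    unfolding lam_continuous_def
  proof (intro ballI)
    fix xs ys assume *: "xs \<in> tuples (univ K) (farity \<tau> F)" "ys \<in> tuples (univ K) (farity \<tau> F)"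
    have "mdist \<tau> M (funI M F (map j xs)) (funI M F (map j ys)) \<le> fmod \<tau> F (tdist \<tau> M (map j xs) (map j ys))"
      using M F *[THEN tup] by (auto simp: is_structure_def lam_continuous_def)
    then show "mdist \<tau> K (funI K F xs) (funI K F ys) \<le> fmod \<tau> F (tdist \<tau> K xs ys)"
      using td[OF *] md funs[OF F] * by simp
  qed
  moreover have "lam_continuous (rmod \<tau> R) (tuples (univ K) (rarity \<tau> R)) (tdist \<tau> K) dist (relI K R)"
    if R: "R \<in> rsyms \<tau>" for R
    unfolding lam_continuous_def
  proof (intro ballI)
    fix xs ys assume *: "xs \<in> tuples (univ K) (rarity \<tau> R)" "ys \<in> tuples (univ K) (rarity \<tau> R)"
    have "dist (relI M R (map j xs)) (relI M R (map j ys)) \<le> rmod \<tau> R (tdist \<tau> M (map j xs) (map j ys))"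
      using M R *[THEN tup] by (auto simp: is_structure_def lam_continuous_def)
    then show "dist (relI K R xs) (relI K R ys) \<le> rmod \<tau> R (tdist \<tau> K xs ys)"
      using td[OF *] rels[OF R] * by simp
  qed
  moreover have "\<bar>relI K R xs\<bar> \<le> rbound \<tau> R" if "R \<in> rsyms \<tau>" "xs \<in> tuples (univ K) (rarity \<tau> R)" for R xs
    using that M rels tup by (simp add: is_structure_def)
  ultimately show ?thesis
    using ne const funs by (auto simp: is_structure_def)
qed

text \<open>
  A formula is read as a Skolem term: \<open>And\<close> is the list constructor and \<open>Or a b\<close> applies the
  operation with code \<open>a\<close> to the list \<open>b\<close>. Thus the Skolem hull is an image of the type of formulas
  and no cardinal arithmetic is needed.
\<close>

primrec skolem :: "(('f, 'r, 'c) fm \<Rightarrow> 'a list \<Rightarrow> 'a) \<Rightarrow> 'a \<Rightarrow> ('f, 'r, 'c) fm \<Rightarrow> 'a \<times> 'a list" where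
  "skolem H c (Num r) = (c, [])"
| "skolem H c (Rel R ts) = (c, [])"
| "skolem H c (Scale r \<phi>) = (c, [])"
| "skolem H c (Add \<phi> \<psi>) = (c, [])"
| "skolem H c (And \<phi> \<psi>) = (c, fst (skolem H c \<phi>) # snd (skolem H c \<psi>))"
| "skolem H c (Or \<phi> \<psi>) = (H \<phi> (snd (skolem H c \<psi>)), [])"
| "skolem H c (SupQ x \<phi>) = (c, [])"
| "skolem H c (InfQ x \<phi>) = (c, [])"

lemma skolem_hull:
  fixes H :: "('f, 'r, 'c) fm \<Rightarrow> 'a list \<Rightarrow> 'a"
  assumes "c \<in> V"
  obtains j :: "('f, 'r, 'c) fm \<Rightarrow> 'a" where "c \<in> range j" "range j \<subseteq> V"
    "\<And>\<phi> xs. set xs \<subseteq> range j \<Longrightarrow> H \<phi> xs \<in> V \<Longrightarrow> H \<phi> xs \<in> range j"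
proof -
  \<comment> \<open>\<open>H\<close> may lead out of \<open>V\<close>. Replacing such values by
    \<open>c\<close> keeps the hull inside \<open>V\<close> and leaves all values in
    \<open>V\<close> as they are.\<close>
  define H' where "H' \<phi> xs = (if H \<phi> xs \<in> V then H \<phi> xs else c)" for \<phi> xs
  define j where "j = fst \<circ> skolem H' c"
  have list: "\<exists>\<psi>. snd (skolem H' c \<psi>) = xs" if "set xs \<subseteq> range j" for xs
    using that
  proof (induction xs)
    case Nil
    \<comment> \<open>\<open>skolem\<close> gives \<open>Num 0\<close> the default pair
      \<open>(c, [])\<close>, so it codes the empty list here and the element \<open>c\<close>
      below.\<close>
    show ?case by (rule exI[of _ "Num 0"]) simp
  next
    case (Cons x xs)
    then obtain \<phi> \<psi> where "x = fst (skolem H' c \<phi>)" "snd (skolem H' c \<psi>) = xs"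
      by (auto simp: j_def)
    then show ?case by (intro exI[of _ "And \<phi> \<psi>"]) simp
  qed
  show thesis
  proof
    show "c \<in> range j" by (rule range_eqI[of _ _ "Num 0"]) (simp add: j_def)
    have "j \<phi> \<in> V" for \<phi>
      unfolding j_def using assms by (cases \<phi>) (auto simp: H'_def)
    then show "range j \<subseteq> V" by auto
    fix \<phi> xs assume "set xs \<subseteq> range j" "H \<phi> xs \<in> V"
    moreover from this obtain \<psi> where "snd (skolem H' c \<psi>) = xs" using list by blast
    ultimately show "H \<phi> xs \<in> range j"
      by (intro range_eqI[of _ _ "Or \<phi> \<psi>"]) (simp add: j_def H'_def)
  qed
qed

text \<open>A point whose value is within \<open>e\<close> of the supremum serves all
  \<open>a\<close> at once. Hence a Skolem function for it depends on the formula, the assignment,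
  \<open>x\<close> and \<open>e\<close>, but not on \<open>a\<close>.\<close>

lemma eval_near_sup:
  assumes M: "is_structure \<tau> M" and "CL_formula \<tau> \<phi>" "range s \<subseteq> univ M" "0 < e"
  obtains u where "u \<in> univ M"
    "\<And>a. a \<in> univ M \<Longrightarrow> eval M (s(x := a)) \<phi> \<le> eval M (s(x := u)) \<phi> + e"
proof -
  let ?G = "\<lambda>a. eval M (s(x := a)) \<phi>"
  have bdd: "bdd_above (?G ` univ M)"
    using assms by (intro bounded_imp_bdd_above eval_update_bounded)
  have "univ M \<noteq> {}" using M by (simp add: is_structure_def)
  then obtain u where "u \<in> univ M" "(SUP a\<in>univ M. ?G a) - e < ?G u"
    using less_cSUP_iff[OF _ bdd, of "(SUP a\<in>univ M. ?G a) - e"] \<open>0 < e\<close> by auto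
  with that show thesis using cSUP_upper[OF _ bdd] by fastforce
qed

text \<open>The hull of \<open>c\<close> under constants, functions and near-maximal witnesses
  passes the Tarski-Vaught test. \<open>K\<close> is a copy of this hull on formulas that code its
  elements.\<close>

lemma loewenheim_skolem:
  fixes M :: "('f, 'r, 'c, 'a) lstruct"
  assumes sig: "is_signature \<tau>" and M: "is_structure \<tau> M" and c: "c \<in> univ M"
  obtains K :: "('f, 'r, 'c, ('f, 'r, 'c) fm) lstruct" and j k
  where "is_structure \<tau> K" "k \<in> univ K" "j k = c"
    "\<And>\<phi> s. CL_formula \<tau> \<phi> \<Longrightarrow> range s \<subseteq> univ K \<Longrightarrow> eval K s \<phi> = eval M (j \<circ> s) \<phi>"
proof -
  define near where "near x e \<phi> xs u \<longleftrightarrow> u \<in> univ M \<and>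
    (\<forall>a\<in>univ M. eval M (((!) xs)(x := a)) \<phi> \<le> eval M (((!) xs)(x := u)) \<phi> + e)" for x e \<phi> xs u
  \<comment> \<open>Formulas are used as tags here. \<open>Rel\<close> with first term
    \<open>App F us\<close> stands for \<open>F\<close>, and with first term \<open>Cst d\<close>
    for the constant \<open>d\<close>; \<open>Add (SupQ x (Num e)) \<psi>'\<close> stands for the
    choice of a witness for the supremum of \<open>\<psi>'\<close> over \<open>x\<close> up to
    \<open>e\<close>.\<close>
  define H :: "('f, 'r, 'c) fm \<Rightarrow> 'a list \<Rightarrow> 'a" where
    "H \<phi> xs = (case \<phi> of Rel R ts \<Rightarrow> (case hd ts of App F us \<Rightarrow> funI M F xs | t \<Rightarrow> teval M ((!) xs) t)
       | Add \<psi> \<psi>' \<Rightarrow> (SOME u. \<exists>x e. \<psi> = SupQ x (Num e) \<and> near x e \<psi>' xs u)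
       | _ \<Rightarrow> c)" for \<phi> xs
  obtain j :: "('f, 'r, 'c) fm \<Rightarrow> 'a" where j: "c \<in> range j" "range j \<subseteq> univ M"
    and closed: "\<And>\<phi> xs. set xs \<subseteq> range j \<Longrightarrow> H \<phi> xs \<in> univ M \<Longrightarrow> H \<phi> xs \<in> range j"
    using skolem_hull[OF c, of H] by blast
  have const: "constI M d \<in> range j" if "d \<in> csyms \<tau>" for d
    using closed[of "[]" "Rel undefined [Cst d]"] M that by (auto simp: H_def is_structure_def)
  have funs: "funI M F xs \<in> range j" if "F \<in> fsyms \<tau>" "xs \<in> tuples (range j) (farity \<tau> F)" for F xs
  proof -
    have "xs \<in> tuples (univ M) (farity \<tau> F)" using that j by (auto simp: tuples_def)
    then have "funI M F xs \<in> univ M" using M that by (auto simp: is_structure_def)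
    then show ?thesis
      using closed[of xs "Rel undefined [App F []]"] that by (auto simp: H_def tuples_def)
  qed
  have witness: "\<exists>u\<in>range j. eval M (s(x := a)) \<phi> \<le> eval M (s(x := u)) \<phi> + e"
    if \<phi>: "CL_formula \<tau> \<phi>" and s: "range s \<subseteq> range j" and a: "a \<in> univ M" and e: "0 < e" for \<phi> s x a e
  proof -
    \<comment> \<open>Skolem operations take lists, so the assignment is cut down to its values at
      \<open>0, ..., n - 1\<close>, which cover the finitely many free variables.\<close>
    have "finite (vars t)" for t :: "('f, 'c) trm" by (induction t) auto
    then have "finite (fv \<phi>)" by (induction \<phi>) auto
    then obtain n where n: "fv \<phi> \<subseteq> {..<n}" by (meson finite_nat_bounded)
    define xs where "xs = map s [0..<n]"
    have xs: "eval M (((!) xs)(x := b)) \<phi> = eval M (s(x := b)) \<phi>" for b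
      using n by (intro eval_cong) (auto simp: xs_def)
    have "\<exists>u. near x e \<phi> xs u"
    proof (rule eval_near_sup[OF M \<phi> _ e, of s x])
      show "range s \<subseteq> univ M" using s j by auto
    qed (auto simp: near_def xs)
    \<comment> \<open>The tag \<open>SupQ x (Num e)\<close> determines \<open>x\<close> and
      \<open>e\<close>, so the element chosen is a witness for these very data.\<close>
    then have "near x e \<phi> xs (H (Add (SupQ x (Num e)) \<phi>) xs)"
      unfolding H_def by (auto intro: someI_ex)
    moreover from this have "H (Add (SupQ x (Num e)) \<phi>) xs \<in> range j"
      using s by (intro closed) (auto simp: near_def xs_def)
    ultimately show ?thesis using a unfolding near_def xs by blast
  qed
  \<comment> \<open>Several formulas may code the same element. \<open>i\<close> selects one code
    for each, and the selected codes form the universe of \<open>K\<close>, on which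
    \<open>j\<close> is injective.\<close>
  define i where "i = inv j"
  have ji: "j (i a) = a" if "a \<in> range j" for a
    using that by (simp add: i_def f_inv_into_f)
  define K :: "('f, 'r, 'c, ('f, 'r, 'c) fm) lstruct" where
    "K = \<lparr>univ = i ` range j, funI = \<lambda>F xs. i (funI M F (map j xs)),
          relI = \<lambda>R xs. relI M R (map j xs), constI = \<lambda>d. i (constI M d)\<rparr>"
  have univK: "univ K = i ` range j" by (simp add: K_def)
  have tup: "map j xs \<in> tuples (range j) n" if "xs \<in> tuples (univ K) n" for xs n
    using that by (auto simp: tuples_def)
  have K: "is_structure \<tau> K"
  proof (rule is_structure_pullback[OF sig M, of K j])
    show "inj_on j (univ K)" unfolding univK by (auto simp: inj_on_def ji)
    show "funI K F xs \<in> univ K \<and> j (funI K F xs) = funI M F (map j xs)"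
      if "F \<in> fsyms \<tau>" "xs \<in> tuples (univ K) (farity \<tau> F)" for F xs
      using funs[OF that(1) tup[OF that(2)]] ji by (auto simp: K_def)
  qed (use j const in \<open>auto simp: K_def\<close>)
  show thesis
  proof
    show "is_structure \<tau> K" by (fact K)
    show "i c \<in> univ K" "j (i c) = c" using j(1) ji by (auto simp: univK)
    show "eval K s \<phi> = eval M (j \<circ> s) \<phi>" if "CL_formula \<tau> \<phi>" "range s \<subseteq> univ K" for \<phi> s
    proof (rule eval_embedding[OF K M _ _ _ _ _ that])
      fix \<phi> x a and s :: "nat \<Rightarrow> ('f, 'r, 'c) fm" and e :: real
      assume *: "CL_formula \<tau> \<phi>" "range s \<subseteq> univ K" "a \<in> univ M" "0 < e"
      obtain u where "u \<in> range j" "eval M ((j \<circ> s)(x := a)) \<phi> \<le> eval M ((j \<circ> s)(x := u)) \<phi> + e"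
        using witness[of \<phi> "j \<circ> s" a e x] * by auto
      then show "\<exists>u\<in>univ K. eval M ((j \<circ> s)(x := a)) \<phi> \<le> eval M ((j \<circ> s)(x := j u)) \<phi> + e"
        by (intro bexI[of _ "i u"]) (auto simp: ji univK)
    qed (use j const ji funs tup in \<open>auto simp: K_def\<close>)
  qed
qed


section \<open>Back and forth\<close>

text \<open>Assignments take the place of tuples, so \<open>R\<close> is not enumerated and several
  variables may carry the same pair. For \<open>R = {}\<close> the notion is agreement on linear
  sentences.\<close>

definition lin_matching ::
  "('f, 'r, 'c) signature \<Rightarrow> ('f, 'r, 'c, 'a) lstruct \<Rightarrow> ('f, 'r, 'c, 'b) lstruct \<Rightarrow> ('a \<times> 'b) set \<Rightarrow> bool" where
  "lin_matching \<tau> M N R \<longleftrightarrow>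
     (\<forall>\<phi> s t. linear_formula \<tau> \<phi> \<and> (\<forall>i\<in>fv \<phi>. (s i, t i) \<in> R) \<longrightarrow> eval M s \<phi> = eval N t \<phi>)"

lemma lin_matchingD:
  "lin_matching \<tau> M N R \<Longrightarrow> linear_formula \<tau> \<phi> \<Longrightarrow> (\<And>i. i \<in> fv \<phi> \<Longrightarrow> (s i, t i) \<in> R) \<Longrightarrow>
    eval M s \<phi> = eval N t \<phi>"
  by (auto simp: lin_matching_def)

lemma lin_matching_converse:
  "lin_matching \<tau> N M (R\<inverse>) \<longleftrightarrow> lin_matching \<tau> M N R"
  by (fastforce simp: lin_matching_def)

text \<open>\<open>d(x, y)\<close> is itself a linear formula, so matchings preserve distances, and
  two partners of \<open>b\<close> are at distance 0. Thus an element of \<open>N\<close> can serve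
  as an unambiguous name for its partner in \<open>M\<close>.\<close>

lemma lin_matching_single_valued:
  assumes sig: "is_signature \<tau>" and M: "is_structure \<tau> M" and N: "is_structure \<tau> N"
    and R: "R \<subseteq> univ M \<times> univ N" "lin_matching \<tau> M N R" "(a, b) \<in> R" "(a', b) \<in> R"
  shows "a = a'"
proof -
  interpret MS: Metric_space "univ M" "mdist \<tau> M" using M by (simp add: is_structure_def)
  interpret NS: Metric_space "univ N" "mdist \<tau> N" using N by (simp add: is_structure_def)
  have "eval M (case_nat a (\<lambda>_. a')) (Rel (dsym \<tau>) [Var 0, Var 1]) =
      eval N (\<lambda>_. b) (Rel (dsym \<tau>) [Var 0, Var 1])"
    using sig R(3,4) by (intro lin_matchingD[OF R(2)]) (auto simp: is_signature_def linear_formula_def)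
  moreover have "a \<in> univ M" "a' \<in> univ M" "b \<in> univ N" using R by auto
  ultimately have "mdist \<tau> M a a' = mdist \<tau> N b b" by (simp add: mdist_def)
  then show ?thesis using \<open>a \<in> univ M\<close> \<open>a' \<in> univ M\<close> \<open>b \<in> univ N\<close> by simp
qed

section \<open>Naming elements by constants and removing the names\<close>

definition name_elems :: "('f, 'r, 'c, 'a) lstruct \<Rightarrow> ('b \<Rightarrow> 'a) \<Rightarrow> ('f, 'r, 'c + 'b, 'a) lstruct" where
  "name_elems M g = \<lparr>univ = univ M, funI = funI M, relI = relI M, constI = case_sum (constI M) g\<rparr>"

lemma expand_eq_name_elems: "expand M = name_elems M id"
  by (simp add: expand_def name_elems_def)

lemma name_elems_simps [simp]:
  "univ (name_elems M g) = univ M" "funI (name_elems M g) = funI M" "relI (name_elems M g) = relI M"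
  "constI (name_elems M g) (Inl d) = constI M d" "constI (name_elems M g) (Inr b) = g b"
  by (simp_all add: name_elems_def)

lemma expand_sig_simps [simp]:
  "fsyms (expand_sig \<tau> A) = fsyms \<tau>" "rsyms (expand_sig \<tau> A) = rsyms \<tau>"
  "csyms (expand_sig \<tau> A) = csyms \<tau> <+> A" "farity (expand_sig \<tau> A) = farity \<tau>"
  "rarity (expand_sig \<tau> A) = rarity \<tau>" "fmod (expand_sig \<tau> A) = fmod \<tau>"
  "rmod (expand_sig \<tau> A) = rmod \<tau>" "rbound (expand_sig \<tau> A) = rbound \<tau>"
  "dsym (expand_sig \<tau> A) = dsym \<tau>"
  by (simp_all add: expand_sig_def)

lemma is_signature_expand_sig: "is_signature \<tau> \<Longrightarrow> is_signature (expand_sig \<tau> A)"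
  by (simp add: is_signature_def)

lemma is_structure_name_elems:
  assumes "is_structure \<tau> M" "g ` A \<subseteq> univ M"
  shows "is_structure (expand_sig \<tau> A) (name_elems M g)"
proof -
  have "mdist (expand_sig \<tau> A) (name_elems M g) = mdist \<tau> M"
    by (intro ext) (simp add: mdist_def)
  moreover from this have "tdist (expand_sig \<tau> A) (name_elems M g) = tdist \<tau> M"
    by (intro ext) (simp add: tdist_def)
  ultimately show ?thesis using assms by (auto simp: is_structure_def)
qed

text \<open>
  The names of the finitely many \<open>b \<in> A\<close> are replaced by odd variables, the variables of the formula
  being moved to the even ones.
\<close>

definition unname :: "('b \<Rightarrow> nat) \<Rightarrow> ('f, 'r, 'c + 'b) fm \<Rightarrow> ('f, 'r, 'c) fm" where
  "unname e = subst_fm (case_sum Cst (\<lambda>b. Var (2 * e b + 1))) (\<lambda>x. 2 * x) (\<lambda>x. Var (2 * x))"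

lemma linear_unname:
  assumes "linear_formula (expand_sig \<tau> A) \<phi>"
  shows "linear_formula \<tau> (unname e \<phi>)"
  unfolding unname_def by (rule linear_subst_fm[OF _ _ _ _ _ _ assms]) auto

lemma fv_unname:
  assumes "CL_formula (expand_sig \<tau> A) \<phi>" "fv \<phi> = {}"
  shows "fv (unname e \<phi>) \<subseteq> (\<lambda>b. 2 * e b + 1) ` A"
  using fv_subst_fm[OF assms(1)] assms(2) unfolding unname_def by fastforce

text \<open>The variable \<open>2 * e b + 1\<close> is assigned \<open>g b\<close>, since halving it
  gives \<open>e b\<close> and \<open>e\<close> is injective on \<open>A\<close>. Even variables
  occur only bound because \<open>\<phi>\<close> is a sentence, so their values do not
  matter.\<close>

lemma eval_unname:
  fixes \<phi> :: "('f, 'r, 'c + 'b) fm"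
  assumes e: "inj_on e A" and \<phi>: "CL_formula (expand_sig \<tau> A) \<phi>" "fv \<phi> = {}"
  shows "eval M (\<lambda>i. g (inv_into A e (i div 2))) (unname e \<phi>) = eval (name_elems M g) s \<phi>"
  unfolding unname_def
proof (rule eval_subst_fm[OF _ _ _ _ _ \<phi>(1)])
  show "vars (case_sum Cst (\<lambda>b. Var (2 * e b + 1)) c) \<inter> range (\<lambda>x. 2 * x) = {}" for c :: "'c + 'b"
    by (cases c) (auto, presburger)
  show "teval M (\<lambda>i. g (inv_into A e (i div 2))) (case_sum Cst (\<lambda>b. Var (2 * e b + 1)) c) =
      constI (name_elems M g) c" if "c \<in> csyms (expand_sig \<tau> A)" for c
    using that e by (auto simp: inv_into_f_f)
qed (use \<phi>(2) in \<open>auto simp: inj_def\<close>)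

text \<open>\<open>unname\<close> turns the parameters into free variables, numbered by means of the
  finiteness of \<open>A\<close>, and there the two assignments take the matched values
  \<open>g b\<close> and \<open>b\<close>. Hence \<open>name_elems M g\<close> satisfies the linear
  theory of \<open>N\<close> over \<open>A\<close>.\<close>

lemma lin_matching_sentence:
  fixes M :: "('f, 'r, 'c, 'a) lstruct" and N :: "('f, 'r, 'c, 'b) lstruct"
  assumes A: "finite A" and match: "lin_matching \<tau> M N R" and R: "\<And>b. b \<in> A \<Longrightarrow> (g b, b) \<in> R"
    and \<phi>: "linear_formula (expand_sig \<tau> A) \<phi>" "fv \<phi> = {}"
  shows "eval (name_elems M g) s \<phi> = eval (name_elems N id) t \<phi>"
proof -
  obtain e :: "'b \<Rightarrow> nat" where e: "inj_on e A"
    using finite_imp_inj_to_nat_seg[OF A] by blast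
  have CL: "CL_formula (expand_sig \<tau> A) \<phi>" using \<phi>(1) by (simp add: linear_formula_def)
  have "eval M (\<lambda>i. g (inv_into A e (i div 2))) (unname e \<phi>) =
      eval N (\<lambda>i. id (inv_into A e (i div 2))) (unname e \<phi>)"
  proof (rule lin_matchingD[OF match linear_unname[OF \<phi>(1)]])
    fix i assume "i \<in> fv (unname e \<phi>)"
    then obtain b where "b \<in> A" "i div 2 = e b" using fv_unname[OF CL \<phi>(2), of e] by auto
    then show "(g (inv_into A e (i div 2)), id (inv_into A e (i div 2))) \<in> R"
      using e R by simp
  qed
  then show ?thesis 
    by (simp only: eval_unname[OF e CL \<phi>(2), where s = s] eval_unname[OF e CL \<phi>(2), where s = t])
qed

section \<open>The linear type of an element and the extension of matchings\<close>

definition true_conds ::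
  "('f, 'r, 'c) signature \<Rightarrow> ('f, 'r, 'c, 'a) lstruct \<Rightarrow> 'a list \<Rightarrow> ('f, 'r, 'c) cond set" where
  "true_conds \<tau> M xs = {c \<in> lin_conds \<tau> (length xs). satisfies M xs {c}}"

text \<open>Every real is a formula, so for the value \<open>r\<close> of \<open>\<phi>\<close> at
  \<open>xs\<close> both \<open>\<phi> \<le> r\<close> and \<open>r \<le> \<phi>\<close> are among
  the conditions, and together they fix the value.\<close>

lemma satisfies_true_condsD:
  assumes "satisfies K ys (true_conds \<tau> M xs)" "linear_formula \<tau> \<phi>" "fv \<phi> \<subseteq> {..<length xs}"
  shows "val K ys \<phi> = val M xs \<phi>"
proof -
  let ?r = "Num (val M xs \<phi>)"
  have "(\<phi>, ?r) \<in> true_conds \<tau> M xs" "(?r, \<phi>) \<in> true_conds \<tau> M xs"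
    using assms(2,3)
    by (auto simp: true_conds_def lin_conds_def satisfies_def linear_formula_def val_def)
  then have "val K ys \<phi> \<le> val K ys ?r" "val K ys ?r \<le> val K ys \<phi>"
    using assms(1) by (auto simp: satisfies_def)
  then show ?thesis by (simp add: val_def)
qed

text \<open>The witness for satisfiability is \<open>name_elems M g\<close> with \<open>c\<close>,
  carried to the type of formulas by \<open>loewenheim_skolem\<close>.\<close>

lemma true_conds_lin_type:
  fixes M :: "('f, 'r, 'c, 'a) lstruct" and N :: "('f, 'r, 'c, 'b) lstruct"
  assumes sig: "is_signature \<tau>" and M: "is_structure \<tau> M"
    and A: "finite A" and match: "lin_matching \<tau> M N R" and g: "\<And>b. b \<in> A \<Longrightarrow> (g b, b) \<in> R"
    and gM: "g ` A \<subseteq> univ M" and c: "c \<in> univ M"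
  shows "true_conds (expand_sig \<tau> A) (name_elems M g) [c] \<in> lin_types \<tau> N A 1"
proof -
  let ?\<tau> = "expand_sig \<tau> A" and ?M = "name_elems M g"
  let ?p = "true_conds ?\<tau> ?M [c]"
  have M': "is_structure ?\<tau> ?M" by (rule is_structure_name_elems[OF M gM])
  obtain K :: "('f, 'r, 'c + 'b, ('f, 'r, 'c + 'b) fm) lstruct" and j k
    where K: "is_structure ?\<tau> K" "k \<in> univ K" "j k = c"
      and elem: "\<And>\<phi> s. CL_formula ?\<tau> \<phi> \<Longrightarrow> range s \<subseteq> univ K \<Longrightarrow> eval K s \<phi> = eval ?M (j \<circ> s) \<phi>"
  proof (rule loewenheim_skolem[OF is_signature_expand_sig[OF sig] M'])
    show "c \<in> univ ?M" using c by simp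
  qed (rule that)
  \<comment> \<open>Both tuples occur in \<open>lin_satisfiable\<close>: the theory is evaluated at
    \<open>[]\<close> to say that \<open>K\<close> is a model, and at \<open>[k]\<close> together
    with the type.\<close>
  have val_k: "val K xs \<phi> = val ?M [c] \<phi>"
    if "linear_formula ?\<tau> \<phi>" "fv \<phi> \<subseteq> {..<length xs}" "xs = [k] \<or> xs = []" for \<phi> xs
  proof -
    have "val K xs \<phi> = eval K (\<lambda>_. k) \<phi>"
      unfolding val_def using that(2,3) by (intro eval_cong) auto
    also have "\<dots> = eval ?M (j \<circ> (\<lambda>_. k)) \<phi>"
      using that(1) K(2) by (intro elem) (auto simp: linear_formula_def)
    also have "\<dots> = val ?M [c] \<phi>"
      unfolding val_def using that(2,3) K(3) by (intro eval_cong) auto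
    finally show ?thesis .
  qed
  have sentence: "val K xs \<phi> = val (expand N) [] \<phi>"
    if "linear_formula ?\<tau> \<phi>" "fv \<phi> = {}" "xs = [k] \<or> xs = []" for \<phi> xs
    using lin_matching_sentence[OF A match g that(1,2)] val_k[of \<phi> xs] that
    by (simp add: val_def expand_eq_name_elems)
  have sat_theory: "satisfies K xs (lin_theory \<tau> N A)" if "xs = [k] \<or> xs = []" for xs
    using sentence that by (auto simp: satisfies_def lin_theory_def lin_conds_def)
  have "satisfies K [k] ?p"
    using val_k by (auto simp: satisfies_def true_conds_def lin_conds_def)
  then have "satisfies K [k] (lin_theory \<tau> N A \<union> ?p)"
    using sat_theory[of "[k]"] by (simp add: satisfies_def ball_Un)
  moreover have "[k] \<in> tuples (univ K) 1" using K(2) by (simp add: tuples_def)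
  ultimately have "lin_satisfiable \<tau> N A 1 ?p"
    unfolding lin_satisfiable_def using K(1) sat_theory by blast
  moreover have "?p \<subseteq> lin_conds ?\<tau> 1" by (auto simp: true_conds_def)
  \<comment> \<open>A tuple satisfying \<open>q\<close> satisfies \<open>?p\<close>, so it gives
    each linear formula the value taken at \<open>c\<close>. Every condition of \<open>q\<close>
    therefore holds at \<open>c\<close> and lies in \<open>?p\<close>.\<close>
  moreover have "q = ?p"
    if "?p \<subseteq> q" and q: "q \<subseteq> lin_conds ?\<tau> 1" and "lin_satisfiable \<tau> N A 1 q" for q
  proof
    obtain L :: "('f, 'r, 'c + 'b, ('f, 'r, 'c + 'b) fm) lstruct" and ys where "satisfies L ys q"
      using \<open>lin_satisfiable \<tau> N A 1 q\<close> unfolding lin_satisfiable_def satisfies_def by blast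
    moreover from this have "satisfies L ys ?p" using \<open>?p \<subseteq> q\<close> by (auto simp: satisfies_def)
    ultimately have same: "val L ys \<phi> = val ?M [c] \<phi>"
      if "linear_formula ?\<tau> \<phi>" "fv \<phi> \<subseteq> {..<1}" for \<phi>
      using that by (intro satisfies_true_condsD) auto
    show "q \<subseteq> ?p"
    proof (rule subrelI)
      fix \<phi> \<psi> assume "(\<phi>, \<psi>) \<in> q"
      moreover from this have "(\<phi>, \<psi>) \<in> lin_conds ?\<tau> 1" using q by blast
      moreover from calculation have "val L ys \<phi> \<le> val L ys \<psi>"
        using \<open>satisfies L ys q\<close> by (auto simp: satisfies_def)
      ultimately show "(\<phi>, \<psi>) \<in> ?p"
        using same by (simp add: true_conds_def satisfies_def lin_conds_def)
    qed
  qed fact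
  ultimately show ?thesis by (auto simp: lin_types_def)
qed

text \<open>The forth step: the partner \<open>d\<close> realizes in \<open>N\<close> the type of
  \<open>c\<close> over the second coordinates of \<open>R\<close>, a finite set of parameters, so
  saturation for \<open>natLeq\<close> applies.\<close>

lemma lin_matching_extend:
  fixes M :: "('f, 'r, 'c, 'a) lstruct" and N :: "('f, 'r, 'c, 'b) lstruct"
  assumes sig: "is_signature \<tau>" and M: "is_structure \<tau> M" and N: "is_structure \<tau> N"
    and sat: "lin_saturated natLeq \<tau> N"
    and R: "finite R" "R \<subseteq> univ M \<times> univ N" "lin_matching \<tau> M N R" and c: "c \<in> univ M"
  obtains d where "d \<in> univ N" "lin_matching \<tau> M N (insert (c, d) R)"
proof -
  define A where "A = snd ` R"
  define g where "g b = (SOME a. (a, b) \<in> R)" for b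
  have g: "(g b, b) \<in> R" if "b \<in> A" for b
    using that unfolding g_def A_def by (auto intro: someI)
  \<comment> \<open>The choice made by \<open>g\<close> is forced, so every pair of
    \<open>R\<close>, and not only the selected ones, is respected by the names.\<close>
  have g_unique: "g b = a" if "(a, b) \<in> R" for a b
    using lin_matching_single_valued[OF sig M N R(2,3), of "g b" b a] g[of b] that
    by (force simp: A_def)
  have A: "finite A" "A \<subseteq> univ N" and gM: "g ` A \<subseteq> univ M"
    using R g by (auto simp: A_def)
  let ?\<tau> = "expand_sig \<tau> A" and ?M = "name_elems M g" and ?N = "name_elems N id"
  have "true_conds ?\<tau> ?M [c] \<in> lin_types \<tau> N A 1"
    by (rule true_conds_lin_type[OF sig M A(1) R(3) g gM c])
  moreover have "|A| <o natLeq" using A(1) by (simp flip: finite_iff_ordLess_natLeq)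
  ultimately have "realized N 1 (true_conds ?\<tau> ?M [c])"
    using sat A(2) by (auto simp: lin_saturated_def)
  then obtain xs where "xs \<in> tuples (univ N) 1" "satisfies ?N xs (true_conds ?\<tau> ?M [c])"
    by (auto simp: realized_def expand_eq_name_elems)
  then obtain d where d: "d \<in> univ N" and sat_d: "satisfies ?N [d] (true_conds ?\<tau> ?M [c])"
    by (auto simp: tuples_def length_Suc_conv)
  have "lin_matching \<tau> M N (insert (c, d) R)"
    unfolding lin_matching_def
  proof (intro allI impI, elim conjE)
    fix \<phi> s t assume \<phi>: "linear_formula \<tau> \<phi>" and st: "\<forall>i\<in>fv \<phi>. (s i, t i) \<in> insert (c, d) R"
    have CL: "CL_formula \<tau> \<phi>" using \<phi> by (simp add: linear_formula_def)
    \<comment> \<open>A variable carrying a pair of \<open>R\<close> becomes a name; any other free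
      variable carries \<open>(c, d)\<close> and becomes \<open>Var 0\<close>. Bound variables are
      shifted by \<open>Suc\<close>, so they cannot capture \<open>Var 0\<close>.\<close>
    define \<sigma> :: "nat \<Rightarrow> ('f, 'c + 'b) trm" where
      "\<sigma> x = (if (s x, t x) \<in> R then Cst (Inr (t x)) else Var 0)" for x
    define \<psi> where "\<psi> = subst_fm (\<lambda>d. Cst (Inl d)) Suc \<sigma> \<phi>"
    have "linear_formula ?\<tau> \<psi>"
      unfolding \<psi>_def by (rule linear_subst_fm[OF _ _ _ _ _ _ \<phi>]) (force simp: \<sigma>_def A_def)+
    moreover have "fv \<psi> \<subseteq> {..<length [c]}"
      using fv_subst_fm[OF CL, of "\<lambda>d. Cst (Inl d)" Suc \<sigma>]
      by (auto simp: \<psi>_def \<sigma>_def split: if_splits)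
    ultimately have "val ?N [d] \<psi> = val ?M [c] \<psi>"
      by (rule satisfies_true_condsD[OF sat_d])
    \<comment> \<open>The name \<open>t x\<close> denotes \<open>g (t x) = s x\<close> in
      \<open>?M\<close> and \<open>t x\<close> itself in \<open>?N\<close>.\<close>
    moreover have "val ?M [c] \<psi> = eval M s \<phi>"
      unfolding val_def \<psi>_def
      by (rule eval_subst_fm[OF _ _ _ _ _ CL]) (use st g_unique in \<open>auto simp: \<sigma>_def\<close>)
    moreover have "val ?N [d] \<psi> = eval N t \<phi>"
      unfolding val_def \<psi>_def
      by (rule eval_subst_fm[OF _ _ _ _ _ CL]) (use st in \<open>auto simp: \<sigma>_def\<close>)
    ultimately show "eval M s \<phi> = eval N t \<phi>" by simp
  qed
  with d show thesis by (rule that)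
qed

section \<open>From linear formulas to CL formulas\<close>

lemma lin_matching_same_values:
  fixes M :: "('f, 'r, 'c, 'a) lstruct" and N :: "('f, 'r, 'c, 'b) lstruct"
  assumes sig: "is_signature \<tau>" and M: "is_structure \<tau> M" and N: "is_structure \<tau> N"
    and sat: "lin_saturated natLeq \<tau> M" "lin_saturated natLeq \<tau> N"
    and IH: "\<And>R s t. finite R \<Longrightarrow> R \<subseteq> univ M \<times> univ N \<Longrightarrow> lin_matching \<tau> M N R \<Longrightarrow>
      (\<And>i. i \<in> fv \<phi> \<Longrightarrow> (s i, t i) \<in> R) \<Longrightarrow> eval M s \<phi> = eval N t \<phi>"
    and R: "finite R" "R \<subseteq> univ M \<times> univ N" "lin_matching \<tau> M N R"
    and st: "\<And>i. i \<in> fv \<phi> - {x} \<Longrightarrow> (s i, t i) \<in> R"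
  shows "(\<lambda>a. eval M (s(x := a)) \<phi>) ` univ M = (\<lambda>b. eval N (t(x := b)) \<phi>) ` univ N"
proof -
  \<comment> \<open>The induction hypothesis is applied to the matching enlarged by the new pair.
    Comparing sets of values rather than their bounds treats sup and inf alike.\<close>
  have eq: "eval M (s(x := a)) \<phi> = eval N (t(x := b)) \<phi>"
    if "a \<in> univ M" "b \<in> univ N" "lin_matching \<tau> M N (insert (a, b) R)" for a b
    by (rule IH[OF _ _ that(3)]) (use that R st in auto)
  have "\<exists>b\<in>univ N. eval M (s(x := a)) \<phi> = eval N (t(x := b)) \<phi>" if "a \<in> univ M" for a
    using lin_matching_extend[OF sig M N sat(2) R that] eq[OF that] by metis
  moreover have "\<exists>a\<in>univ M. eval M (s(x := a)) \<phi> = eval N (t(x := b)) \<phi>" if b: "b \<in> univ N" for b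
  proof -
    \<comment> \<open>The back step is the forth step for the converse matching, with the saturation
      of \<open>M\<close>.\<close>
    obtain a where a: "a \<in> univ M" and "lin_matching \<tau> N M (insert (b, a) (R\<inverse>))"
    proof (rule lin_matching_extend[OF sig N M sat(1) _ _ _ b])
      show "finite (R\<inverse>)" "R\<inverse> \<subseteq> univ N \<times> univ M" "lin_matching \<tau> N M (R\<inverse>)"
        using R by (auto simp: lin_matching_converse)
    qed
    moreover have "insert (b, a) (R\<inverse>) = (insert (a, b) R)\<inverse>" by auto
    ultimately have "lin_matching \<tau> M N (insert (a, b) R)" by (simp only: lin_matching_converse)
    then show ?thesis using eq[OF a b] a by blast
  qed
  ultimately show ?thesis by (auto simp: image_iff) metis
qed

text \<open>Atomic formulas are linear and hence preserved, and connectives act on values that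
  already agree. \<open>R\<close> varies in the induction because each quantifier adds a pair; it
  stays finite, as the forth step requires.\<close>

lemma lin_matching_CL:
  fixes M :: "('f, 'r, 'c, 'a) lstruct" and N :: "('f, 'r, 'c, 'b) lstruct"
  assumes sig: "is_signature \<tau>" and M: "is_structure \<tau> M" and N: "is_structure \<tau> N"
    and sat: "lin_saturated natLeq \<tau> M" "lin_saturated natLeq \<tau> N"
  shows "CL_formula \<tau> \<phi> \<Longrightarrow> finite R \<Longrightarrow> R \<subseteq> univ M \<times> univ N \<Longrightarrow> lin_matching \<tau> M N R \<Longrightarrow>
    (\<And>i. i \<in> fv \<phi> \<Longrightarrow> (s i, t i) \<in> R) \<Longrightarrow> eval M s \<phi> = eval N t \<phi>"
proof (induction \<phi> arbitrary: R s t)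
  case (SupQ x \<phi>)
  have "(\<lambda>a. eval M (s(x := a)) \<phi>) ` univ M = (\<lambda>b. eval N (t(x := b)) \<phi>) ` univ N"
    using SupQ by (intro lin_matching_same_values[OF assms, of \<phi> R]) auto
  then show ?case by simp
next
  case (InfQ x \<phi>)
  have "(\<lambda>a. eval M (s(x := a)) \<phi>) ` univ M = (\<lambda>b. eval N (t(x := b)) \<phi>) ` univ N"
    using InfQ by (intro lin_matching_same_values[OF assms, of \<phi> R]) auto
  then show ?case by simp
next
  case (Rel R' ts)
  then show ?case by (intro lin_matchingD[OF Rel.prems(4)]) (auto simp: linear_formula_def)
next
  case (Scale r \<phi>)
  have "eval M s \<phi> = eval N t \<phi>"
    by (rule Scale.IH[of R]) (use Scale.prems in simp_all)
  then show ?case by simp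
next
  case (Add \<phi> \<psi>)
  have "eval M s \<phi> = eval N t \<phi>" "eval M s \<psi> = eval N t \<psi>"
    by (rule Add.IH[of R], use Add.prems in simp_all)+
  then show ?case by simp
next
  case (And \<phi> \<psi>)
  have "eval M s \<phi> = eval N t \<phi>" "eval M s \<psi> = eval N t \<psi>"
    by (rule And.IH[of R], use And.prems in simp_all)+
  then show ?case by simp
next
  case (Or \<phi> \<psi>)
  have "eval M s \<phi> = eval N t \<phi>" "eval M s \<psi> = eval N t \<psi>"
    by (rule Or.IH[of R], use Or.prems in simp_all)+
  then show ?case by simp
qed simp

theorem proposition4p5:
  fixes \<tau> :: "('f, 'r, 'c) signature"
    and M :: "('f, 'r, 'c, 'a) lstruct"
    and N :: "('f, 'r, 'c, 'b) lstruct"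
  assumes "is_signature \<tau>"
    and "is_structure \<tau> M" and "is_structure \<tau> N"
    and "lin_equiv \<tau> M N"
    and "lin_saturated natLeq \<tau> M" and "lin_saturated natLeq \<tau> N"
  shows "CL_equiv \<tau> M N"
  unfolding CL_equiv_def
proof (intro allI impI, elim conjE)
  fix \<sigma> :: "('f, 'r, 'c) fm" assume \<sigma>: "CL_formula \<tau> \<sigma>" "fv \<sigma> = {}"
  \<comment> \<open>A formula whose free variables are matched by the empty relation is a sentence,
    so linear equivalence starts the back and forth.\<close>
  have "lin_matching \<tau> M N {}"
    unfolding lin_matching_def
  proof (intro allI impI, elim conjE)
    fix \<phi> :: "('f, 'r, 'c) fm" and s :: "nat \<Rightarrow> 'a" and t :: "nat \<Rightarrow> 'b"
    assume \<phi>: "linear_formula \<tau> \<phi>" "\<forall>i\<in>fv \<phi>. (s i, t i) \<in> {}"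
    then have "eval M s \<phi> = val M [] \<phi>" "eval N t \<phi> = val N [] \<phi>"
      unfolding val_def by (auto intro: eval_cong)
    with \<phi> assms(4) show "eval M s \<phi> = eval N t \<phi>" by (auto simp: lin_equiv_def)
  qed
  then show "val M [] \<sigma> = val N [] \<sigma>"
    unfolding val_def using \<sigma>
    by (intro lin_matching_CL[OF assms(1-3,5,6), where R = "{}"]) auto
qed

end
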